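(* Let $(E_1,\rho_1)$, $(E_2,\rho_2)$ be metric spaces, let $A:E_1\to E_2$ be a continuous one-to-one operator, let $F\in E_2$ and let $f\in E_1$ be the (unique) solution of $Af=F$. Let $W:E_1\to\mathbb R_{\ge0}$ be a lower semi-continuous function such that the sets $W^{-1}([0,c])$, $c\ge0$, are all compact. For each $l\in\mathbb N^+$ let $(\mathcal X_l,\mu_l)$ be a probability space, let $S_l\mapsto F_{S_l}\in E_2$ and $S_l\mapsto A_{S_l}$ be maps defined on $\mathcal X_l$, where $A_{S_l}:E_1\to E_2$ are operators belonging, together with $A$, to a given space $\mathcal A$ of operators, and let $\gamma_l>0$. For each $S_l\in\mathcal X_l$ let $f_{S_l}\in E_1$ be a $\gamma_l^2$-minimizer of $$R^*_{\gamma_l}(\hat f,F_{S_l},A_{S_l})=\rho_2^2(A_{S_l}\hat f,F_{S_l})+\gamma_lW(\hat f),\qquad \hat f\in E_1 .$$ Then for any $\varepsilon>0$ and any constants $C_1,C_2>0$ there exists a value $\gamma_0>0$ such that for any $\gamma_l\le\gamma_0$ $$(\mu_l)^*\{S_l\in\mathcal X_l:\rho_1(f_{S_l},f)>\varepsilon\}\le(\mu_l)^*\{S_l\in\mathcal X_l:\rho_2(F_{S_l},F)>C_1\sqrt{\gamma_l}\}+(\mu_l)^*\{S_l\in\mathcal X_l:\|A_{S_l}-A\|>C_2\sqrt{\gamma_l}\}$$ holds true.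
   Context: For $\eta>0$, $f_{S_l}\in E_1$ is an $\eta$-minimizer of $R^*_{\gamma_l}$ if $R^*_{\gamma_l}(f_{S_l},F_{S_l},A_{S_l})\le R^*_{\gamma_l}(\hat f,F_{S_l},A_{S_l})+\eta$ for all $\hat f\in E_1$. The distance between operators is $$\|A_{S_l}-A\|=\sup_{\hat f\in E_1}\frac{\rho_2(A_{S_l}\hat f,A\hat f)}{W^{1/2}(\hat f)} .$$ For a measure $\nu$ on a space $\mathcal X$ and an arbitrary subset $S\subset\mathcal X$, $\nu^*(S)=\inf\{\nu(B):S\subset B,\ B\text{ measurable}\}$ is the outer measure. No measurability of the maps $S_l\mapsto F_{S_l},A_{S_l},f_{S_l}$ is assumed. *)

theory Defs
  imports "HOL-Probability.Probability"
begin

definition lower_semicontinuous :: "('a::topological_space \<Rightarrow> real) \<Rightarrow> bool" where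
  "lower_semicontinuous W \<longleftrightarrow> (\<forall>x. \<forall>c < W x. \<forall>\<^sub>F y in nhds x. c < W y)"

text \<open>
  In the functional below \<open>B\<close> is the (possibly perturbed) operator, \<open>G\<close> the (possibly perturbed)
  right-hand side and \<open>g\<close> the regularization parameter.
\<close>

definition reg_functional ::
  "('a \<Rightarrow> real) \<Rightarrow> real \<Rightarrow> 'a \<Rightarrow> 'b::metric_space \<Rightarrow> ('a \<Rightarrow> 'b) \<Rightarrow> real" where
  "reg_functional W g h G B = (dist (B h) G)\<^sup>2 + g * W h"

definition eta_minimizer :: "real \<Rightarrow> ('a \<Rightarrow> real) \<Rightarrow> 'a \<Rightarrow> bool" where
  "eta_minimizer \<eta> R x \<longleftrightarrow> (\<forall>h. R x \<le> R h + \<eta>)"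

text \<open>
  The supremum may be infinite and \<open>W\<close> may vanish, so the quotients are formed in \<^typ>\<open>ennreal\<close>.
  There \<open>a / 0 = \<infinity>\<close> for \<open>a > 0\<close> and \<open>0 / 0 = 0\<close>. Real division, with its \<open>a / 0 = 0\<close>, would
  disregard the behaviour of the operators on the zero set of \<open>W\<close>.
\<close>

definition op_distance ::
  "('a \<Rightarrow> real) \<Rightarrow> ('a \<Rightarrow> 'b::metric_space) \<Rightarrow> ('a \<Rightarrow> 'b) \<Rightarrow> ennreal" where
  "op_distance W B A = (SUP h. ennreal (dist (B h) (A h)) / ennreal (sqrt (W h)))"

end

theory Submission
  imports Defs
begin

text \<open>
  Outside the two exceptional events, comparing the functional at \<open>f\<^bsub>S\<^esub>\<close> with its value at \<open>f\<close>
  bounds \<open>W f\<^bsub>S\<^esub>\<close> by a constant independent of \<open>\<gamma>\<close> and bounds \<open>\<rho>\<^sub>2 (A f\<^bsub>S\<^esub>, F)\<close> by a multiple of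
  \<open>\<surd>\<gamma>\<close>. On a compact sublevel set of \<open>W\<close> with the \<open>\<epsilon>\<close>-ball around \<open>f\<close> removed, the continuous
  function \<open>\<rho>\<^sub>2 (A x, F)\<close> has a positive minimum, so for small \<open>\<gamma>\<close> the point \<open>f\<^bsub>S\<^esub>\<close> lies in that ball.
  The claim is then subadditivity of the outer measure.
\<close>

text \<open>The infimum defining the outer measure is attained by a measurable envelope. The
  envelopes of two arbitrary sets together cover their union, which reduces the claim to
  subadditivity on measurable sets.\<close>

lemma outer_measure_of_Un_le:
  assumes "A \<subseteq> space M" "B \<subseteq> space M"
  shows "outer_measure_of M (A \<union> B) \<le> outer_measure_of M A + outer_measure_of M B"
proof -
  obtain A' where A': "A' \<in> sets M" "A \<subseteq> A'" "outer_measure_of M A = emeasure M A'"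
    using outer_measure_of_attain[OF assms(1)] by blast
  obtain B' where B': "B' \<in> sets M" "B \<subseteq> B'" "outer_measure_of M B = emeasure M B'"
    using outer_measure_of_attain[OF assms(2)] by blast
  have "outer_measure_of M (A \<union> B) \<le> emeasure M (A' \<union> B')"
    unfolding outer_measure_of_def using A' B' by (intro INF_lower) auto
  also have "\<dots> \<le> emeasure M A' + emeasure M B'"
    using A' B' by (intro emeasure_subadditive) auto
  finally show ?thesis
    using A' B' by simp
qed

text \<open>Where \<open>W h = 0\<close>, a finite bound forces \<open>B h = A h\<close>, since a
  positive number over 0 is \<open>\<top>\<close> in \<open>ennreal\<close>. Elsewhere the quotient
  is an ordinary real one.\<close>

lemma dist_le_of_op_distance_le:
  assumes "op_distance W B A \<le> ennreal c" "c \<ge> 0" "W h \<ge> 0"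
  shows "dist (B h) (A h) \<le> c * sqrt (W h)"
proof -
  have le: "ennreal (dist (B h) (A h)) / ennreal (sqrt (W h)) \<le> ennreal c"
    using assms(1) unfolding op_distance_def by (meson SUP_upper UNIV_I order_trans)
  show ?thesis
  proof (cases "W h = 0")
    case True
    have "dist (B h) (A h) = 0"
    proof (rule ccontr)
      assume "dist (B h) (A h) \<noteq> 0"
      then have "ennreal (dist (B h) (A h)) / ennreal (sqrt (W h)) = \<top>"
        using True by (simp add: ennreal_divide_eq_top_iff)
      with le show False
        by (simp add: top_unique)
    qed
    with True show ?thesis by simp
  next
    case False
    with assms(3) have "sqrt (W h) > 0" by simp
    with le assms(2) show ?thesis
      by (simp add: divide_ennreal pos_divide_le_eq)
  qed
qed

text \<open>At \<open>f\<close> the data and operator errors are both of order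
  \<open>sqrt g\<close>, so the functional there is of order \<open>g\<close>. Near-minimality
  passes this on to \<open>x\<close>, where it controls the penalty and the residual
  separately.\<close>

lemma minimizer_bounds:
  fixes A B :: "'a \<Rightarrow> 'b::metric_space" and W :: "'a \<Rightarrow> real" and C1 C2 :: real and f :: 'a
  defines "K \<equiv> (C2 * sqrt (W f) + C1)\<^sup>2 + W f + 1"
  assumes W: "\<And>h. W h \<ge> 0"
    and g: "0 < g" "g \<le> 1" and C: "C1 \<ge> 0" "C2 \<ge> 0"
    and min: "eta_minimizer (g\<^sup>2) (\<lambda>h. reg_functional W g h G B) x"
    and G: "dist G (A f) \<le> C1 * sqrt g"
    and B: "op_distance W B A \<le> ennreal (C2 * sqrt g)"
  shows "W x \<le> K"
    and "dist (A x) (A f) \<le> sqrt g * (C1 + (1 + C2) * sqrt K)"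
proof -
  have dB: "dist (B h) (A h) \<le> C2 * sqrt g * sqrt (W h)" for h
    using dist_le_of_op_distance_le[OF B _ W] C g by simp
  have "dist (B f) G \<le> dist (B f) (A f) + dist G (A f)"
    by (rule dist_triangle2)
  also have "\<dots> \<le> sqrt g * (C2 * sqrt (W f) + C1)"
    using dB[of f] G by (simp add: algebra_simps)
  finally have "(dist (B f) G)\<^sup>2 \<le> (sqrt g * (C2 * sqrt (W f) + C1))\<^sup>2"
    by (intro power_mono) auto
  then have "(dist (B f) G)\<^sup>2 \<le> g * (C2 * sqrt (W f) + C1)\<^sup>2"
    using g by (simp add: power_mult_distrib)
  moreover have "(dist (B x) G)\<^sup>2 + g * W x \<le> (dist (B f) G)\<^sup>2 + g * W f + g\<^sup>2"
    using min by (simp add: eta_minimizer_def reg_functional_def)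
  \<comment> \<open>The slack of the near-minimizer is absorbed by the summand 1 in
    \<open>K\<close>.\<close>
  moreover have "g\<^sup>2 \<le> g * 1"
    unfolding power2_eq_square using g by (intro mult_left_mono) auto
  ultimately have main: "(dist (B x) G)\<^sup>2 + g * W x \<le> g * K"
    by (simp add: K_def algebra_simps)
  then have "g * W x \<le> g * K"
    using zero_le_power2[of "dist (B x) G"] by linarith
  then show Wx: "W x \<le> K"
    using g by simp
  have "(dist (B x) G)\<^sup>2 \<le> g * K"
    using main W[of x] g by (smt (verit) mult_nonneg_nonneg)
  then have dG: "dist (B x) G \<le> sqrt g * sqrt K"
    by (simp add: real_le_rsqrt flip: real_sqrt_mult)
  \<comment> \<open>The operator error at \<open>x\<close> grows with \<open>sqrt (W x)\<close>; the
    bound on \<open>W x\<close> just obtained makes it uniform in \<open>x\<close>.\<close>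
  have "C2 * sqrt g * sqrt (W x) \<le> C2 * sqrt g * sqrt K"
    using Wx C g by (intro mult_left_mono) auto
  then have dA: "dist (A x) (B x) \<le> C2 * sqrt g * sqrt K"
    using dB[of x] by (simp add: dist_commute)
  have "dist (A x) (A f) \<le> dist (A x) (B x) + (dist (B x) G + dist G (A f))"
    by (meson add_left_mono dist_triangle order_trans)
  with dA dG G show "dist (A x) (A f) \<le> sqrt g * (C1 + (1 + C2) * sqrt K)"
    by (simp add: algebra_simps)
qed

text \<open>This is continuity at \<open>A f\<close> of the inverse of \<open>A\<close> restricted
  to a compact set; \<open>f\<close> itself may lie outside \<open>S\<close>.\<close>

lemma inj_continuous_separation_on_compact:
  fixes A :: "'a::metric_space \<Rightarrow> 'b::metric_space"
  assumes "continuous_on UNIV A" "inj A" "compact S" "\<epsilon> > 0"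
  obtains \<delta> where "\<delta> > 0" "\<And>x. x \<in> S \<Longrightarrow> dist (A x) (A f) < \<delta> \<Longrightarrow> dist x f < \<epsilon>"
proof -
  let ?S = "S \<inter> - ball f \<epsilon>"
  have S: "compact ?S"
    using assms(3) by (intro compact_Int_closed) auto
  have cont: "continuous_on ?S (\<lambda>x. dist (A x) (A f))"
    by (intro continuous_intros continuous_on_subset[OF assms(1)]) auto
  show thesis
  proof (cases "?S = {}")
    \<comment> \<open>All of \<open>S\<close> lies in the ball, so any positive \<delta>
      serves.\<close>
    case True
    then show thesis
      by (intro that[of 1]) (auto simp: dist_commute)
  next
    case False
    then obtain y where y: "y \<in> ?S" "\<And>x. x \<in> ?S \<Longrightarrow> dist (A y) (A f) \<le> dist (A x) (A f)"
      using continuous_attains_inf[OF S _ cont] by blast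
    have "y \<noteq> f"
      using y(1) assms(4) by auto
    then have "dist (A y) (A f) > 0"
      using assms(2) by (simp add: inj_eq)
    moreover have "dist x f < \<epsilon>" if "x \<in> S" "dist (A x) (A f) < dist (A y) (A f)" for x
      using y(2)[of x] that by (force simp: dist_commute)
    ultimately show thesis
      by (rule that)
  qed
qed

theorem theorem6p1:
  fixes A :: "'a::metric_space \<Rightarrow> 'b::metric_space"
    and F :: 'b and f :: 'a
    and W :: "'a \<Rightarrow> real"
    and \<A> :: "('a \<Rightarrow> 'b) set"
    and \<mu> :: "nat \<Rightarrow> 'x measure"
    and FS :: "nat \<Rightarrow> 'x \<Rightarrow> 'b"
    and AS :: "nat \<Rightarrow> 'x \<Rightarrow> 'a \<Rightarrow> 'b"
    and fS :: "nat \<Rightarrow> 'x \<Rightarrow> 'a"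
    and \<gamma> :: "nat \<Rightarrow> real"
    and \<epsilon> C1 C2 :: real
  assumes A_cont: "continuous_on UNIV A"
    and A_inj: "inj A"
    and f_sol: "A f = F"
    and W_nonneg: "\<And>x. W x \<ge> 0"
    and W_lsc: "lower_semicontinuous W"
    and W_compact: "\<And>c. c \<ge> 0 \<Longrightarrow> compact (W -` {0..c})"
    and prob: "\<And>l. l \<ge> 1 \<Longrightarrow> prob_space (\<mu> l)"
    and A_space: "A \<in> \<A>"
    and AS_space: "\<And>l s. l \<ge> 1 \<Longrightarrow> s \<in> space (\<mu> l) \<Longrightarrow> AS l s \<in> \<A>"
    and \<gamma>_pos: "\<And>l. l \<ge> 1 \<Longrightarrow> \<gamma> l > 0"
    and fS_min: "\<And>l s. l \<ge> 1 \<Longrightarrow> s \<in> space (\<mu> l) \<Longrightarrow>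
      eta_minimizer ((\<gamma> l)\<^sup>2) (\<lambda>h. reg_functional W (\<gamma> l) h (FS l s) (AS l s)) (fS l s)"
    and eps_pos: "\<epsilon> > 0" and C1_pos: "C1 > 0" and C2_pos: "C2 > 0"
  shows "\<exists>\<gamma>0 > 0. \<forall>l \<ge> 1. \<gamma> l \<le> \<gamma>0 \<longrightarrow>
    outer_measure_of (\<mu> l) {s \<in> space (\<mu> l). dist (fS l s) f > \<epsilon>}
    \<le> outer_measure_of (\<mu> l) {s \<in> space (\<mu> l). dist (FS l s) F > C1 * sqrt (\<gamma> l)}
      + outer_measure_of (\<mu> l)
          {s \<in> space (\<mu> l). op_distance W (AS l s) A > ennreal (C2 * sqrt (\<gamma> l))}"
proof -
  \<comment> \<open>The constant of \<open>minimizer_bounds\<close>. It does not involve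
    \<open>\<gamma> l\<close>, so \<delta> can be fixed before \<open>\<gamma>0\<close>.\<close>
  define K where "K = (C2 * sqrt (W f) + C1)\<^sup>2 + W f + 1"
  have "K > 0"
    using W_nonneg[of f] by (auto simp: K_def intro!: add_nonneg_pos)
  obtain \<delta> where \<delta>: "\<delta> > 0"
    and sep: "\<And>x. x \<in> W -` {0..K} \<Longrightarrow> dist (A x) (A f) < \<delta> \<Longrightarrow> dist x f < \<epsilon>"
    using inj_continuous_separation_on_compact[OF A_cont A_inj W_compact eps_pos] \<open>K > 0\<close>
    by (metis less_imp_le)
  define M where "M = C1 + (1 + C2) * sqrt K"
  have "M > 0"
    using C1_pos C2_pos \<open>K > 0\<close> by (simp add: M_def add_pos_pos)
  \<comment> \<open>The cap 1 meets the requirement \<open>g \<le> 1\<close> of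
    \<open>minimizer_bounds\<close>; the factor 2 turns \<open>\<gamma> l \<le> \<gamma>0\<close>
    into the strict inequality \<open>sqrt (\<gamma> l) * M < \<delta>\<close>.\<close>
  define \<gamma>0 where "\<gamma>0 = min 1 ((\<delta> / (2 * M))\<^sup>2)"
  have "\<gamma>0 > 0"
    using \<delta> \<open>M > 0\<close> by (simp add: \<gamma>0_def)
  show ?thesis
  proof (intro exI[of _ \<gamma>0] conjI allI impI)
    fix l :: nat
    assume l: "1 \<le> l" and small: "\<gamma> l \<le> \<gamma>0"
    let ?D = "{s \<in> space (\<mu> l). dist (fS l s) f > \<epsilon>}"
    let ?P = "{s \<in> space (\<mu> l). dist (FS l s) F > C1 * sqrt (\<gamma> l)}"
    let ?Q = "{s \<in> space (\<mu> l). op_distance W (AS l s) A > ennreal (C2 * sqrt (\<gamma> l))}"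
    have "sqrt (\<gamma> l) \<le> \<delta> / (2 * M)"
      using small \<delta> \<open>M > 0\<close> by (intro real_le_lsqrt) (auto simp: \<gamma>0_def)
    then have "sqrt (\<gamma> l) * M \<le> \<delta> / 2"
      using \<open>M > 0\<close> by (simp add: field_simps)
    then have lt: "sqrt (\<gamma> l) * M < \<delta>"
      using \<delta> by linarith
    have "?D \<subseteq> ?P \<union> ?Q"
    proof (intro subsetI, rule ccontr)
      fix s
      assume "s \<in> ?D" and "s \<notin> ?P \<union> ?Q"
      then have s: "s \<in> space (\<mu> l)" "dist (fS l s) f > \<epsilon>"
        "dist (FS l s) (A f) \<le> C1 * sqrt (\<gamma> l)"
        "op_distance W (AS l s) A \<le> ennreal (C2 * sqrt (\<gamma> l))"
        by (auto simp: f_sol not_less)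
      have "\<gamma> l \<le> 1"
        using small by (simp add: \<gamma>0_def)
      note bounds = minimizer_bounds[OF W_nonneg \<gamma>_pos[OF l] this less_imp_le[OF C1_pos]
          less_imp_le[OF C2_pos] fS_min[OF l s(1)] s(3,4), folded K_def, folded M_def]
      \<comment> \<open>The first bound puts \<open>fS l s\<close> in the compact sublevel set, the
        second puts its image within \<delta> of \<open>A f\<close>.\<close>
      have "dist (fS l s) f < \<epsilon>"
        using bounds lt W_nonneg by (intro sep) auto
      with s(2) show False by simp
    qed
    then have "outer_measure_of (\<mu> l) ?D \<le> outer_measure_of (\<mu> l) (?P \<union> ?Q)"
      by (rule outer_measure_of_mono)
    also have "\<dots> \<le> outer_measure_of (\<mu> l) ?P + outer_measure_of (\<mu> l) ?Q"
      by (intro outer_measure_of_Un_le) auto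
    finally show "outer_measure_of (\<mu> l) ?D \<le> outer_measure_of (\<mu> l) ?P + outer_measure_of (\<mu> l) ?Q" .
  qed (fact \<open>\<gamma>0 > 0\<close>)
qed

end
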